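(* For every $d\ge1$ and every $d$-regular graph $G$, if the edges of $G$ arrive in a uniformly random order, the greedy algorithm (which adds an arriving edge whenever the current set plus that edge is a matching) outputs a matching of expected size at least $\left(1-\frac1e\right)|\textsc{OPT}|$, where $\textsc{OPT}$ is a maximum matching of $G$. *)

theory Defs
  imports "HOL-Probability.Probability" "HOL-Combinatorics.Multiset_Permutations"
begin

definition simple_graph :: "'a set \<Rightarrow> 'a set set \<Rightarrow> bool" where
  "simple_graph V E \<longleftrightarrow> finite V \<and> (\<forall>e\<in>E. \<exists>u v. u \<in> V \<and> v \<in> V \<and> u \<noteq> v \<and> e = {u, v})"

definition degree :: "'a set set \<Rightarrow> 'a \<Rightarrow> nat" where
  "degree E v = card {e \<in> E. v \<in> e}"

definition regular :: "nat \<Rightarrow> 'a set \<Rightarrow> 'a set set \<Rightarrow> bool" where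
  "regular d V E \<longleftrightarrow> (\<forall>v\<in>V. degree E v = d)"

definition is_matching :: "'a set set \<Rightarrow> 'a set set \<Rightarrow> bool" where
  "is_matching E M \<longleftrightarrow> M \<subseteq> E \<and> (\<forall>e1\<in>M. \<forall>e2\<in>M. e1 \<noteq> e2 \<longrightarrow> e1 \<inter> e2 = {})"

definition is_max_matching :: "'a set set \<Rightarrow> 'a set set \<Rightarrow> bool" where
  "is_max_matching E M \<longleftrightarrow> is_matching E M \<and> (\<forall>M'. is_matching E M' \<longrightarrow> card M' \<le> card M)"

definition greedy_step :: "'a set set \<Rightarrow> 'a set \<Rightarrow> 'a set set" where
  "greedy_step M e = (if (\<forall>f\<in>M. f \<noteq> e \<longrightarrow> f \<inter> e = {}) then insert e M else M)"

definition greedy :: "'a set list \<Rightarrow> 'a set set" where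
  "greedy es = foldl greedy_step {} es"

definition expected_greedy :: "'a set set \<Rightarrow> real" where
  "expected_greedy E = measure_pmf.expectation (pmf_of_set (permutations_of_set E)) (\<lambda>es. real (card (greedy es)))"

end

theory Submission
  imports Defs
begin

text \<open>
  If the first edge to arrive at some neighbour \<open>u\<close> of \<open>v\<close> is \<open>{u, v}\<close>, then \<open>u\<close> is free at that
  moment and \<open>v\<close> is matched from then on. So it suffices to show that, for a fixed \<open>v\<close>, with
  probability at most \<open>1/e\<close> no neighbour has this property. Call a neighbour fresh while none of its
  edges has arrived. By induction on the remaining edges, the failure probability with \<open>k\<close> fresh
  neighbours is at most \<open>exp (- k / d)\<close>: the next edge is one of the \<open>k\<close> favourable ones, or
  destroys \<open>j \<in> {0, 1, 2}\<close> fresh neighbours and costs a factor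
  \<open>exp (j / d) \<le> 1 + j / (d - 1)\<close>. The numbers \<open>j\<close> over the unfavourable edges sum to
  \<open>k * (d - 1)\<close>, so the total excess is at most \<open>k\<close>, which the favourable edges compensate.
  Dependence between neighbours that are adjacent to each other is thus harmless.
  Summing over \<open>v\<close> gives an expected size of at least \<open>(1 - 1/e) * card V / 2\<close>.
\<close>

section \<open>Bounds on the exponential function\<close>

lemma exp_two_mult_le:
  fixes x :: real
  assumes "0 \<le> x" "x < 1"
  shows "exp (2 * x) \<le> (1 + x) / (1 - x)"
proof -
  \<comment> \<open>The logarithm of the claim: \<open>f 0 = 0\<close> and \<open>f\<close> has
    derivative 2 y^2 / (1 - y^2), which is nonnegative on [0, x].\<close>
  define f where "f = (\<lambda>y::real. ln (1 + y) - ln (1 - y) - 2 * y)"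
  have "f 0 \<le> f x"
  proof (rule DERIV_nonneg_imp_nondecreasing[OF assms(1)])
    fix y assume y: "0 \<le> y" "y \<le> x"
    then have y1: "y < 1" using assms by simp
    have "(f has_real_derivative (1 / (1 + y) + 1 / (1 - y) - 2)) (at y)"
      unfolding f_def using y y1 by (auto intro!: derivative_eq_intros)
    moreover have "1 / (1 + y) + 1 / (1 - y) - 2 = 2 * y\<^sup>2 / ((1 + y) * (1 - y))"
      using y y1 by (simp add: divide_simps power2_eq_square) (simp add: algebra_simps)
    ultimately show "\<exists>l. (f has_real_derivative l) (at y) \<and> 0 \<le> l"
      using y y1 by (intro exI[of _ "1 / (1 + y) + 1 / (1 - y) - 2"]) simp
  qed
  then have "2 * x \<le> ln ((1 + x) / (1 - x))"
    using assms by (simp add: f_def ln_div)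
  then have "exp (2 * x) \<le> exp (ln ((1 + x) / (1 - x)))"
    by simp
  then show ?thesis using assms by simp
qed

text \<open>An edge meets at most two fresh vertices, hence \<open>j \<le> 2\<close>; already
  \<open>j = 3\<close>, \<open>d = 2\<close> would break the bound. The case \<open>j = 1\<close>
  inverts 1 - 1/d \<le> exp (-1/d).\<close>

lemma exp_div_le_one_plus:
  fixes d j :: nat
  assumes "2 \<le> d" "j \<le> 2"
  shows "exp (real j / real d) \<le> 1 + real j / (real d - 1)"
proof -
  consider "j = 0" | "j = 1" | "j = 2" using assms(2) by linarith
  then show ?thesis
  proof cases
    case 1
    then show ?thesis by simp
  next
    case 2
    have "1 - 1 / real d \<le> exp (- (1 / real d))"
      using exp_ge_add_one_self[of "- (1 / real d)"] by simp
    then have "(1 - 1 / real d) * exp (1 / real d) \<le> 1"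
      by (simp add: exp_minus field_simps)
    then show ?thesis using 2 assms(1) by (simp add: field_simps)
  next
    case 3
    have "exp (2 * (1 / real d)) \<le> (1 + 1 / real d) / (1 - 1 / real d)"
      by (rule exp_two_mult_le) (use assms in auto)
    also have "\<dots> = 1 + 2 / (real d - 1)"
      using assms by (simp add: field_simps)
    finally show ?thesis using 3 by simp
  qed
qed

section \<open>Counting the arrival orders that leave a vertex unmatched\<close>

definition unmatched_orders :: "'a \<Rightarrow> 'a set set \<Rightarrow> 'a set set \<Rightarrow> 'a set list set" where
  "unmatched_orders v M A = {es \<in> permutations_of_set A. v \<notin> \<Union>(foldl greedy_step M es)}"

lemma subset_greedy_step: "M \<subseteq> greedy_step M e"
  by (auto simp: greedy_step_def)

lemma subset_foldl_greedy_step: "M \<subseteq> foldl greedy_step M es"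
proof (induction es arbitrary: M)
  case (Cons e es)
  then show ?case using subset_greedy_step[of M e] by (metis foldl_Cons order_trans)
qed simp

lemma unmatched_orders_eq_empty:
  assumes "v \<in> \<Union>M"
  shows "unmatched_orders v M A = {}"
  using assms subset_foldl_greedy_step[of M] by (auto simp: unmatched_orders_def)

text \<open>Splits by the first edge \<open>x\<close>. What follows is again a greedy run, from
  another matching and with fewer edges, which is why \<open>unmatched_orders\<close> takes both
  \<open>M\<close> and \<open>A\<close>.\<close>

lemma card_unmatched_orders:
  assumes "finite A" "A \<noteq> {}"
  shows "card (unmatched_orders v M A)
    = (\<Sum>x\<in>A. card (unmatched_orders v (greedy_step M x) (A - {x})))"
proof -
  have "unmatched_orders v M A
    = (\<Union>x\<in>A. (#) x ` unmatched_orders v (greedy_step M x) (A - {x}))"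
    using permutations_of_set_nonempty[OF assms(2)] by (auto simp: unmatched_orders_def)
  also have "card \<dots>
    = (\<Sum>x\<in>A. card ((#) x ` unmatched_orders v (greedy_step M x) (A - {x})))"
    by (rule card_UN_disjoint) (use assms in \<open>auto simp: unmatched_orders_def\<close>)
  also have "\<dots> = (\<Sum>x\<in>A. card (unmatched_orders v (greedy_step M x) (A - {x})))"
    by (intro sum.cong refl card_image) (auto simp: inj_on_def)
  finally show ?thesis .
qed

text \<open>Double counting: each vertex of \<open>S\<close> lies on \<open>d\<close> edges of
  \<open>A\<close>, exactly one of which joins it to \<open>v\<close>.\<close>

lemma sum_exp_fresh_le:
  fixes A :: "'a set set"
  assumes A: "finite A" "\<And>x. x \<in> A \<Longrightarrow> card x = 2"
    and S: "finite S" "v \<notin> S"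
      "\<And>u. u \<in> S \<Longrightarrow> {u, v} \<in> A" "\<And>u. u \<in> S \<Longrightarrow> degree A u = d"
  shows "(\<Sum>x\<in>A - (\<lambda>u. {u, v}) ` S. exp (real (card (x \<inter> S)) / real d)) \<le> real (card A)"
proof -
  define P where "P = (\<lambda>u. {u, v}) ` S"
  have P: "P \<subseteq> A" "finite P" using S by (auto simp: P_def)
  have "inj_on (\<lambda>u. {u, v}) S" by (auto simp: inj_on_def doubleton_eq_iff)
  then have cardP: "card P = card S" by (simp add: P_def card_image)
  have "(\<Sum>x\<in>A. card {u \<in> S. u \<in> x}) = d * card S"
    by (rule sum_multicount) (use A S in \<open>auto simp: degree_def\<close>)
  moreover have "{u \<in> S. u \<in> x} = x \<inter> S" for x by auto
  ultimately have "(\<Sum>x\<in>A. card (x \<inter> S)) = d * card S" by simp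
  moreover have "card (x \<inter> S) = 1" if x: "x \<in> P" for x
  proof -
    obtain u where "u \<in> S" "x = {u, v}" using x by (auto simp: P_def)
    then have "x \<inter> S = {u}" using S(2) by auto
    then show ?thesis by simp
  qed
  ultimately have "(\<Sum>x\<in>A - P. card (x \<inter> S)) + card S = d * card S"
    using sum.subset_diff[OF P(1) A(1), of "\<lambda>x. card (x \<inter> S)"] cardP by simp
  then have sumN: "(\<Sum>x\<in>A - P. real (card (x \<inter> S))) = (real d - 1) * real (card S)"
    by (simp add: algebra_simps flip: of_nat_sum of_nat_add of_nat_mult)
  have "exp (real (card (x \<inter> S)) / real d) \<le> 1 + real (card (x \<inter> S)) / (real d - 1)"
    if x: "x \<in> A - P" for x
  proof (cases "x \<inter> S = {}")
    case False
    then obtain u where u: "u \<in> x" "u \<in> S" by auto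
    \<comment> \<open>\<open>x\<close> and \<open>{u, v}\<close> are two different edges at
      \<open>u\<close>, so \<open>d\<close> is at least 2 and the exponential bound applies.\<close>
    have "{x, {u, v}} \<subseteq> {y \<in> A. u \<in> y}" using x u S by auto
    then have "card {x, {u, v}} \<le> d"
      using card_mono[of "{y \<in> A. u \<in> y}"] A(1) S(4)[OF u(2)] by (simp add: degree_def)
    moreover have "x \<noteq> {u, v}" using x u by (auto simp: P_def)
    ultimately have "2 \<le> d" by simp
    moreover have "finite x" "card x = 2"
      using A(2)[of x] x by (auto intro: card_ge_0_finite)
    then have "card (x \<inter> S) \<le> 2" using card_mono[of x "x \<inter> S"] by simp
    ultimately show ?thesis by (rule exp_div_le_one_plus)
  qed simp
  then have "(\<Sum>x\<in>A - P. exp (real (card (x \<inter> S)) / real d))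
    \<le> (\<Sum>x\<in>A - P. 1 + real (card (x \<inter> S)) / (real d - 1))"
    by (rule sum_mono)
  also have "\<dots> = real (card (A - P)) + (real d - 1) * real (card S) / (real d - 1)"
    by (simp add: sum.distrib sumN flip: sum_divide_distrib)
  \<comment> \<open>Only an inequality, since for \<open>d = 1\<close> the quotient is 0 by the
    convention on division by zero.\<close>
  also have "\<dots> \<le> real (card (A - P)) + real (card S)"
    by simp
  also have "\<dots> = real (card A)"
    using card_Diff_subset[OF P(2,1)] card_mono[OF A(1) P(1)] cardP by simp
  finally show ?thesis by (simp add: P_def)
qed

text \<open>\<open>S\<close> may be any set of fresh neighbours of \<open>v\<close>. Only its
  members need degree \<open>d\<close> in \<open>A\<close>, so the hypotheses survive the removal of
  an edge \<open>x\<close> once \<open>S\<close> shrinks to \<open>S - x\<close>.\<close>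

lemma card_unmatched_orders_le:
  fixes A :: "'a set set"
  assumes "finite A" "\<And>x. x \<in> A \<Longrightarrow> card x = 2"
    and "finite S" "v \<notin> S" "v \<notin> \<Union>M" "S \<inter> \<Union>M = {}"
    and "\<And>u. u \<in> S \<Longrightarrow> {u, v} \<in> A" "\<And>u. u \<in> S \<Longrightarrow> degree A u = d"
  shows "real (card (unmatched_orders v M A)) \<le> exp (- (real (card S) / real d)) * fact (card A)"
  using assms
proof (induction "card A" arbitrary: A S M)
  case 0
  then have "A = {}" by simp
  moreover from this have "S = {}" using 0 by auto
  moreover have "card (unmatched_orders v M {}) \<le> card {[] :: 'a set list}"
    by (rule card_mono) (auto simp: unmatched_orders_def)
  ultimately show ?case by simp
next
  case (Suc n)
  define P where "P = (\<lambda>u. {u, v}) ` S"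
  \<comment> \<open>The induction hypothesis gives exactly \<open>c\<close> for a first edge that
    meets no vertex of \<open>S\<close>.\<close>
  define c where "c = exp (- (real (card S) / real d)) * fact n"
  let ?B = "\<lambda>x. unmatched_orders v (greedy_step M x) (A - {x})"
  have PA: "P \<subseteq> A" using Suc.prems by (auto simp: P_def)
  have A: "A \<noteq> {}" using Suc by auto
  \<comment> \<open>Both ends of such an edge are still free, so greedy accepts it and matches
    \<open>v\<close>.\<close>
  have P0: "card (?B x) = 0" if x: "x \<in> P" for x
  proof -
    obtain u where u: "u \<in> S" "x = {u, v}" using x by (auto simp: P_def)
    have "f \<inter> x = {}" if "f \<in> M" for f
      using Suc.prems(5,6) u that by auto
    then have "v \<in> \<Union>(greedy_step M x)" using u by (simp add: greedy_step_def)
    then show ?thesis by (simp add: unmatched_orders_eq_empty)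
  qed
  have N: "real (card (?B x)) \<le> c * exp (real (card (x \<inter> S)) / real d)" if x: "x \<in> A - P" for x
  \<comment> \<open>An edge outside \<open>P\<close> can also match \<open>v\<close>, through a
    neighbour not in \<open>S\<close>; then no failing order remains.\<close>
  proof (cases "v \<in> \<Union>(greedy_step M x)")
    case True
    then show ?thesis by (simp add: unmatched_orders_eq_empty c_def)
  next
    case False
    have cardA: "card (A - {x}) = n" using x Suc.hyps(2) Suc.prems(1) by simp
    have "greedy_step M x \<subseteq> insert x M" by (auto simp: greedy_step_def)
    then have "(S - x) \<inter> \<Union>(greedy_step M x) = {}" using Suc.prems(6) by blast
    moreover have "degree (A - {x}) u = d" if "u \<in> S - x" for u
    proof -
      have "{e \<in> A - {x}. u \<in> e} = {e \<in> A. u \<in> e}" using that by auto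
      then show ?thesis using Suc.prems(8)[of u] that by (simp add: degree_def)
    qed
    ultimately have "real (card (?B x))
      \<le> exp (- (real (card (S - x)) / real d)) * fact (card (A - {x}))"
      using Suc.prems False cardA by (intro Suc.hyps(1)) auto
    also have "real (card (S - x)) = real (card S) - real (card (x \<inter> S))"
    proof -
      have "card S = card (S \<inter> x) + card (S - x)"
        by (rule card_Int_Diff) (use Suc.prems in simp)
      then show ?thesis by (simp add: Int_commute)
    qed
    finally show ?thesis
      by (simp add: cardA c_def diff_divide_distrib exp_diff exp_minus field_simps)
  qed
  have "real (card (unmatched_orders v M A)) = (\<Sum>x\<in>A. real (card (?B x)))"
    using card_unmatched_orders[OF Suc.prems(1) A, of v M] by simp
  also have "\<dots> = (\<Sum>x\<in>A - P. real (card (?B x)))"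
    using P0 Suc.prems(1) by (intro sum.mono_neutral_right) auto
  also have "\<dots> \<le> c * (\<Sum>x\<in>A - P. exp (real (card (x \<inter> S)) / real d))"
    unfolding sum_distrib_left by (intro sum_mono N)
  also have "\<dots> \<le> c * real (card A)"
    unfolding P_def using Suc.prems
    by (intro mult_left_mono sum_exp_fresh_le) (auto simp: c_def)
  also have "\<dots> = exp (- (real (card S) / real d)) * fact (card A)"
    by (simp add: c_def Suc.hyps(2)[symmetric] algebra_simps)
  finally show ?case .
qed

section \<open>Simple graphs and their matchings\<close>

lemma simple_graph_edge:
  assumes "simple_graph V E" "e \<in> E"
  shows "card e = 2" "e \<subseteq> V"
  using assms by (fastforce simp: simple_graph_def)+

lemma simple_graph_finite_edges:
  assumes "simple_graph V E"
  shows "finite E"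
  using assms simple_graph_edge(2)[OF assms]
  by (intro finite_subset[of E "Pow V"]) (auto simp: simple_graph_def)

lemma card_Union_matching:
  assumes "simple_graph V E" "is_matching E M"
  shows "card (\<Union>M) = 2 * card M" "\<Union>M \<subseteq> V"
proof -
  have E: "card e = 2" "e \<subseteq> V" if "e \<in> M" for e
    using that assms simple_graph_edge[OF assms(1)] by (auto simp: is_matching_def)
  have "card (\<Union>M) = sum card M"
  proof (rule card_Union_disjoint)
    show "pairwise disjnt M"
      using assms(2) by (auto simp: is_matching_def pairwise_def disjnt_def)
  qed (use E(1) in \<open>auto intro: card_ge_0_finite\<close>)
  then show "card (\<Union>M) = 2 * card M" using E by simp
  show "\<Union>M \<subseteq> V" using E by auto
qed

lemma is_matching_foldl_greedy_step:
  assumes "is_matching E M" "set es \<subseteq> E"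
  shows "is_matching E (foldl greedy_step M es)"
  using assms
proof (induction es arbitrary: M)
  case (Cons e es)
  then have "is_matching E (greedy_step M e)"
    unfolding is_matching_def greedy_step_def by (simp, blast)
  then show ?case using Cons by simp
qed simp

text \<open>Before any arrival all \<open>d\<close> neighbours of \<open>v\<close> are fresh, so the
  exponent is - d / d = -1.\<close>

lemma card_unmatched_orders_regular:
  assumes "simple_graph V E" "regular d V E" "d \<ge> 1" "v \<in> V"
  shows "real (card (unmatched_orders v {} E)) \<le> exp (- 1) * fact (card E)"
proof -
  define S where "S = {u. {u, v} \<in> E}"
  have SV: "S \<subseteq> V" using simple_graph_edge(2)[OF assms(1)] by (auto simp: S_def)
  have vS: "v \<notin> S" using simple_graph_edge(1)[OF assms(1), of "{v}"] by (auto simp: S_def)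
  have "{e \<in> E. v \<in> e} = (\<lambda>u. {u, v}) ` S"
  proof (intro equalityI subsetI)
    fix e assume e: "e \<in> {e \<in> E. v \<in> e}"
    then obtain a b where "e = {a, b}" using assms(1) by (auto simp: simple_graph_def)
    then have "e = {a, v} \<or> e = {b, v}" using e by auto
    then show "e \<in> (\<lambda>u. {u, v}) ` S" using e by (auto simp: S_def)
  qed (auto simp: S_def)
  moreover have "inj_on (\<lambda>u. {u, v}) S" by (auto simp: inj_on_def doubleton_eq_iff)
  ultimately have "card S = degree E v" by (simp add: degree_def card_image)
  then have "card S = d" using assms by (simp add: regular_def)
  moreover have "real (card (unmatched_orders v {} E))
    \<le> exp (- (real (card S) / real d)) * fact (card E)"
  proof (rule card_unmatched_orders_le)
    show "finite E" using assms(1) by (rule simple_graph_finite_edges)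
    show "card x = 2" if "x \<in> E" for x using simple_graph_edge(1)[OF assms(1) that] .
    show "finite S" using SV assms(1) by (auto simp: simple_graph_def intro: finite_subset)
    show "degree E u = d" if "u \<in> S" for u using that SV assms(2) by (auto simp: regular_def)
  qed (use vS in \<open>auto simp: S_def\<close>)
  ultimately show ?thesis using assms(3) by simp
qed

theorem theorem6:
  fixes V :: "'a set" and E :: "'a set set" and d :: nat and OPT :: "'a set set"
  assumes "d \<ge> 1"
    and "simple_graph V E"
    and "regular d V E"
    and "is_max_matching E OPT"
  shows "expected_greedy E \<ge> (1 - 1 / exp 1) * real (card OPT)"
proof -
  let ?P = "permutations_of_set E"
  have finV: "finite V" using assms(2) by (simp add: simple_graph_def)
  have finE: "finite E" using assms(2) by (rule simple_graph_finite_edges)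
  have OPT: "2 * card OPT \<le> card V"
    using card_Union_matching[OF assms(2), of OPT] assms(4) card_mono[OF finV, of "\<Union>OPT"]
    by (simp add: is_max_matching_def)
  have greedy: "2 * real (card (greedy es)) = real (card V) - real (card {v \<in> V. v \<notin> \<Union>(greedy es)})"
    if "es \<in> ?P" for es
  proof -
    have "is_matching E (greedy es)"
      unfolding greedy_def using that
      by (intro is_matching_foldl_greedy_step) (auto simp: is_matching_def permutations_of_set_def)
    note M = card_Union_matching[OF assms(2) this]
    have "card V = card (V \<inter> \<Union>(greedy es)) + card (V - \<Union>(greedy es))"
      by (rule card_Int_Diff[OF finV])
    moreover have "V \<inter> \<Union>(greedy es) = \<Union>(greedy es)" using M(2) by auto
    moreover have "V - \<Union>(greedy es) = {v \<in> V. v \<notin> \<Union>(greedy es)}" by auto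
    ultimately show ?thesis using M(1) by simp
  qed
  \<comment> \<open>Counts the pairs of an order and a vertex it leaves unmatched in two
    ways.\<close>
  have "(\<Sum>es\<in>?P. card {v \<in> V. v \<notin> \<Union>(greedy es)})
    = (\<Sum>v\<in>V. card (unmatched_orders v {} E))"
    by (rule sum_multicount_gen)
      (use finV finE in \<open>auto simp: unmatched_orders_def greedy_def\<close>)
  then have "(\<Sum>es\<in>?P. real (card {v \<in> V. v \<notin> \<Union>(greedy es)}))
    = (\<Sum>v\<in>V. real (card (unmatched_orders v {} E)))"
    by (simp flip: of_nat_sum)
  also have "\<dots> \<le> (\<Sum>v\<in>V. exp (- 1) * fact (card E))"
    using card_unmatched_orders_regular[OF assms(2,3,1)] by (intro sum_mono)
  finally have unmatched: "(\<Sum>es\<in>?P. real (card {v \<in> V. v \<notin> \<Union>(greedy es)}))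
    \<le> real (card V) * exp (- 1) * fact (card E)" by simp
  have "2 * (\<Sum>es\<in>?P. real (card (greedy es)))
    = (\<Sum>es\<in>?P. real (card V) - real (card {v \<in> V. v \<notin> \<Union>(greedy es)}))"
    unfolding sum_distrib_left by (intro sum.cong refl greedy)
  also have "\<dots> = real (card V) * fact (card E)
    - (\<Sum>es\<in>?P. real (card {v \<in> V. v \<notin> \<Union>(greedy es)}))"
    using finE by (simp add: sum_subtractf)
  finally have "real (card V) * (1 - exp (- 1)) * fact (card E)
    \<le> 2 * (\<Sum>es\<in>?P. real (card (greedy es)))"
    using unmatched by (simp add: algebra_simps)
  moreover have "expected_greedy E = (\<Sum>es\<in>?P. real (card (greedy es))) / fact (card E)"
    unfolding expected_greedy_def using finE
    by (subst integral_pmf_of_set) auto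
  ultimately have "real (card V) * (1 - exp (- 1)) * fact (card E)
    \<le> 2 * expected_greedy E * fact (card E)"
    by simp
  then have "(1 - exp (- 1)) * (real (card V) / 2) \<le> expected_greedy E"
    by (simp add: mult_le_cancel_right mult.commute)
  \<comment> \<open>\<open>OPT\<close> enters only here, through the bound \<open>card V / 2\<close>
    that holds for every matching.\<close>
  moreover have "(1 - exp (- 1)) * real (card OPT) \<le> (1 - exp (- 1)) * (real (card V) / 2)"
    using OPT by (intro mult_left_mono) auto
  ultimately have "(1 - exp (- 1)) * real (card OPT) \<le> expected_greedy E"
    by linarith
  then show ?thesis by (simp add: exp_minus inverse_eq_divide)
qed

end
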